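(* Let $M^n\subset\mathbb{R}^{n+1}$ be a closed hypersurface. Then $$W^{l^\infty}_{n-1}(M^n)\leq 3^{\frac{1}{n}}\,\mathrm{vol}(M^n)^{\frac{1}{n}}\leq 3\,\mathrm{vol}(M^n)^{\frac{1}{n}}.$$
   Context: For $x\in\mathbb{R}^N$, $\Vert x\Vert_{l^\infty}=\max_i |x_i|$. For a closed manifold $M^n\subset\mathbb{R}^N$, its $l^\infty$-width $W^{l^\infty}_{n-1}(M^n)$ is the infimum, over all $(n-1)$-dimensional polyhedra $K^{n-1}\subset\mathbb{R}^N$ and all continuous maps $\phi:M^n\to K^{n-1}$, of $\sup_{x\in M^n}\Vert x-\phi(x)\Vert_{l^\infty}$. Here $\mathrm{vol}(M^n)$ is the $n$-dimensional Euclidean volume of $M^n$. *)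

theory Defs
  imports "HOL-Analysis.Analysis"
begin

coinductive smooth_on :: "'a::euclidean_space set \<Rightarrow> ('a \<Rightarrow> real) \<Rightarrow> bool" where
  "\<lbrakk>\<forall>x\<in>U. f differentiable (at x);
    \<forall>b\<in>Basis. smooth_on U (\<lambda>x. frechet_derivative f (at x) b)\<rbrakk>
   \<Longrightarrow> smooth_on U f"

definition closed_hypersurface :: "'a::euclidean_space set \<Rightarrow> bool" where
  "closed_hypersurface M \<longleftrightarrow> compact M \<and> M \<noteq> {} \<and>
     (\<forall>p\<in>M. \<exists>U f. open U \<and> p \<in> U \<and> smooth_on U f \<and>
        (\<forall>x\<in>U. frechet_derivative f (at x) \<noteq> (\<lambda>v. 0)) \<and>
        M \<inter> U = {x\<in>U. f x = 0})"

definition polyhedron_dim_le :: "nat \<Rightarrow> 'a::euclidean_space set \<Rightarrow> bool" where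
  "polyhedron_dim_le k K \<longleftrightarrow>
     (\<exists>\<T>. finite \<T> \<and> (\<forall>S\<in>\<T>. \<exists>d. d \<le> int k \<and> d simplex S) \<and> K = \<Union>\<T>)"

definition linf_width :: "nat \<Rightarrow> 'a::euclidean_space set \<Rightarrow> real" where
  "linf_width k M = Inf {r. \<exists>K \<phi>. polyhedron_dim_le k K \<and> continuous_on M \<phi> \<and> \<phi> ` M \<subseteq> K \<and>
                              r = (SUP x\<in>M. infnorm (x - \<phi> x))}"

text \<open>Normalized n-dimensional Hausdorff measure (coincides with the n-dimensional
  Euclidean volume on smooth n-dimensional submanifolds).\<close>
definition hausdorff_pre :: "nat \<Rightarrow> real \<Rightarrow> 'a::euclidean_space set \<Rightarrow> ennreal" where
  "hausdorff_pre n \<delta> A = (INF C\<in>{C :: nat \<Rightarrow> 'a set. A \<subseteq> (\<Union>i. C i) \<and>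
                                  (\<forall>i. bounded (C i) \<and> diameter (C i) \<le> \<delta>)}.
        (\<Sum>i. ennreal (unit_ball_vol (real n) * (diameter (C i) / 2) ^ n)))"

definition hausdorff_measure :: "nat \<Rightarrow> 'a::euclidean_space set \<Rightarrow> ennreal" where
  "hausdorff_measure n A = (SUP \<delta>\<in>{0<..}. hausdorff_pre n \<delta> A)"

end

theory Submission
  imports Defs
begin

text \<open>Take a cubic grid of side \<open>s\<close>. Cover \<open>M\<close> by small sets and replace each by a ball of radius
  \<open>sqrt 3 / 2\<close> times its diameter. For each coordinate direction \<open>i\<close>, the translations of the grid
  for which a line of the grid parallel to \<open>i\<close> meets such a ball form, modulo the lattice, a
  set of measure at most that of a cylinder of height \<open>s\<close> over an \<open>n\<close>-ball. Summing over the
  \<open>n + 1\<close> directions and using \<open>(n + 1) (sqrt 3)^n \<le> 3 * 2^n\<close>, these translations do not exhaust a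
  period cube as soon as \<open>(s / 2)^n > 3 vol M\<close>. For a translation outside them \<open>M\<close> misses the
  1-skeleton of the grid, so it can be pushed radially onto the dual \<open>(n - 1)\<close>-skeleton, which moves
  no coordinate by more than \<open>s / 2\<close>.\<close>

section \<open>Finiteness of the area\<close>

lemma mvt_inner_segment:
  fixes f :: "'a::euclidean_space \<Rightarrow> real"
  assumes "\<And>z. z \<in> closed_segment y x \<Longrightarrow> f differentiable (at z)"
  obtains z where "z \<in> closed_segment y x" "f x - f y = frechet_derivative f (at z) (x - y)"
proof -
  define g where "g = (\<lambda>\<tau>::real. f (y + \<tau> *\<^sub>R (x - y)))"
  have seg: "y + \<tau> *\<^sub>R (x - y) \<in> closed_segment y x" if "0 \<le> \<tau>" "\<tau> \<le> 1" for \<tau>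
    using that by (auto simp: closed_segment_def algebra_simps intro!: exI[of _ \<tau>])
  have der: "(g has_real_derivative frechet_derivative f (at (y + \<tau> *\<^sub>R (x - y))) (x - y)) (at \<tau>)"
    if "0 \<le> \<tau>" "\<tau> \<le> 1" for \<tau>
  proof -
    let ?D = "frechet_derivative f (at (y + \<tau> *\<^sub>R (x - y)))"
    have D: "(f has_derivative ?D) (at (y + \<tau> *\<^sub>R (x - y)))"
      using assms[OF seg[OF that]] frechet_derivative_works by blast
    have "((\<lambda>\<tau>. y + \<tau> *\<^sub>R (x - y)) has_derivative (\<lambda>h. h *\<^sub>R (x - y))) (at \<tau>)"
      by (auto intro!: derivative_eq_intros)
    from has_derivative_compose[OF this D]
    have "(g has_derivative (\<lambda>h. ?D (h *\<^sub>R (x - y)))) (at \<tau>)"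
      by (simp add: g_def)
    moreover have "?D (h *\<^sub>R (x - y)) = ?D (x - y) * h" for h
      using has_derivative_linear[OF D] by (simp add: linear_cmul)
    ultimately show ?thesis
      by (simp add: has_field_derivative_def)
  qed
  obtain \<tau> where \<tau>: "0 < \<tau>" "\<tau> < 1"
    "g 1 - g 0 = (1 - 0) * frechet_derivative f (at (y + \<tau> *\<^sub>R (x - y))) (x - y)"
    using MVT2[of 0 1 g, OF _ der] by auto
  show thesis
    by (rule that[OF seg[of \<tau>]]) (use \<tau> in \<open>auto simp: g_def\<close>)
qed

text \<open>The inequality says that the projection along \<open>b\<close> is injective on level sets near \<open>p\<close>, with
  Lipschitz inverse; for local finiteness of area this replaces the implicit function theorem.\<close>

lemma level_set_cone_condition:
  fixes f :: "'a::euclidean_space \<Rightarrow> real"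
  assumes "open U" "p \<in> U" and diff: "\<And>x. x \<in> U \<Longrightarrow> f differentiable (at x)"
    and cont: "\<And>b. b \<in> Basis \<Longrightarrow> isCont (\<lambda>x. frechet_derivative f (at x) b) p"
    and nz: "frechet_derivative f (at p) \<noteq> (\<lambda>v. 0)"
  obtains e L b where "e > 0" "L \<ge> 0" "b \<in> Basis" "ball p e \<subseteq> U"
    "\<And>x y. x \<in> ball p e \<Longrightarrow> y \<in> ball p e \<Longrightarrow> f x = f y \<Longrightarrow>
       \<bar>(x - y) \<bullet> b\<bar> \<le> L * (\<Sum>c\<in>Basis - {b}. \<bar>(x - y) \<bullet> c\<bar>)"
proof -
  define D where "D = (\<lambda>x. frechet_derivative f (at x))"
  have lin: "linear (D x)" if "x \<in> U" for x
    using diff[OF that] unfolding D_def by (rule linear_frechet_derivative)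
  have "\<exists>b\<in>Basis. D p b \<noteq> 0"
  proof (rule ccontr)
    assume "\<not> ?thesis"
    then have "D p = (\<lambda>v. 0)"
      by (intro linear_eq_stdbasis lin \<open>p \<in> U\<close>) (auto simp: linear_zero module_hom_zero)
    then show False using nz by (simp add: D_def)
  qed
  then obtain b where b: "b \<in> Basis" "D p b \<noteq> 0" by blast
  \<comment> \<open>Half of the nonzero partial derivative is the tolerance: where all partial
    derivatives differ from those at \<open>p\<close> by less than \<open>m\<close>, the one along
    \<open>b\<close> keeps absolute value at least \<open>m\<close> and the others stay below
    \<open>B\<close>.\<close>
  define m where "m = \<bar>D p b\<bar> / 2"
  have "m > 0" using b by (simp add: m_def)
  define B where "B = (\<Sum>c\<in>Basis. \<bar>D p c\<bar>) + m"
  have "\<forall>\<^sub>F x in nhds p. \<bar>D x c - D p c\<bar> < m" if "c \<in> Basis" for c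
  proof -
    have "((\<lambda>x. D x c) \<longlongrightarrow> D p c) (nhds p)"
      using cont[OF that] tendsto_at_iff_tendsto_nhds[of "\<lambda>x. D x c" p]
      unfolding D_def isCont_def by blast
    from tendstoD[OF this \<open>m > 0\<close>] show ?thesis by (simp add: dist_real_def)
  qed
  then have "\<forall>\<^sub>F x in nhds p. \<forall>c\<in>Basis. \<bar>D x c - D p c\<bar> < m"
    by (simp add: eventually_ball_finite_distrib)
  moreover have "\<forall>\<^sub>F x in nhds p. x \<in> U"
    using \<open>open U\<close> \<open>p \<in> U\<close> by (rule eventually_nhds_in_open)
  ultimately have "\<forall>\<^sub>F x in nhds p. x \<in> U \<and> (\<forall>c\<in>Basis. \<bar>D x c - D p c\<bar> < m)"
    by eventually_elim auto
  then obtain e where "e > 0" and e: "\<And>x. dist x p < e \<Longrightarrow> x \<in> U \<and> (\<forall>c\<in>Basis. \<bar>D x c - D p c\<bar> < m)"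
    unfolding eventually_nhds_metric by blast
  have "B \<ge> 0" using \<open>m > 0\<close> by (simp add: B_def sum_nonneg)
  show thesis
  proof (rule that[of e "B / m" b])
    show "e > 0" "b \<in> Basis" by fact+
    show "B / m \<ge> 0" using \<open>B \<ge> 0\<close> \<open>m > 0\<close> by simp
    show "ball p e \<subseteq> U" using e by (auto simp: dist_commute)
    fix x y assume xy: "x \<in> ball p e" "y \<in> ball p e" "f x = f y"
    have sub: "closed_segment y x \<subseteq> ball p e"
      by (rule closed_segment_subset) (use xy in auto)
    then obtain z where z: "z \<in> closed_segment y x" "f x - f y = D z (x - y)"
      using mvt_inner_segment[of y x f] diff e unfolding D_def
      by (metis dist_commute mem_ball subsetD)
    have zU: "z \<in> U" and zc: "\<And>c. c \<in> Basis \<Longrightarrow> \<bar>D z c - D p c\<bar> < m"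
      using e[of z] z sub by (auto simp: dist_commute)
    have "D z (x - y) = D z (\<Sum>c\<in>Basis. ((x - y) \<bullet> c) *\<^sub>R c)"
      by (simp add: euclidean_representation)
    also have "\<dots> = (\<Sum>c\<in>Basis. ((x - y) \<bullet> c) * D z c)"
      using lin[OF zU] by (simp add: linear_sum linear_cmul)
    also have "\<dots> = ((x - y) \<bullet> b) * D z b + (\<Sum>c\<in>Basis - {b}. ((x - y) \<bullet> c) * D z c)"
      using b by (simp add: sum.remove)
    \<comment> \<open>On a level set the increment of \<open>f\<close> vanishes, so the mean value
      theorem gives a linear relation among the coordinates of \<open>x - y\<close>, to be solved
      for the one along \<open>b\<close>.\<close>
    finally have eq: "((x - y) \<bullet> b) * D z b = - (\<Sum>c\<in>Basis - {b}. ((x - y) \<bullet> c) * D z c)"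
      using z xy by simp
    have "m \<le> \<bar>D z b\<bar>" using zc[OF b(1)] unfolding m_def by linarith
    then have "m * \<bar>(x - y) \<bullet> b\<bar> \<le> \<bar>(x - y) \<bullet> b\<bar> * \<bar>D z b\<bar>"
      by (simp add: mult.commute mult_right_mono)
    also have "\<dots> = \<bar>\<Sum>c\<in>Basis - {b}. ((x - y) \<bullet> c) * D z c\<bar>"
      by (metis abs_minus_cancel abs_mult eq)
    also have "\<dots> \<le> (\<Sum>c\<in>Basis - {b}. \<bar>((x - y) \<bullet> c) * D z c\<bar>)" by (rule sum_abs)
    also have "\<dots> \<le> (\<Sum>c\<in>Basis - {b}. B * \<bar>(x - y) \<bullet> c\<bar>)"
    proof (rule sum_mono)
      fix c assume c: "c \<in> Basis - {b}"
      have "\<bar>D p c\<bar> \<le> (\<Sum>c\<in>Basis. \<bar>D p c\<bar>)"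
        using c by (intro member_le_sum) auto
      then have "\<bar>D z c\<bar> \<le> B" using zc[of c] c unfolding B_def by auto
      then show "\<bar>((x - y) \<bullet> c) * D z c\<bar> \<le> B * \<bar>(x - y) \<bullet> c\<bar>"
        by (simp add: abs_mult mult.commute mult_right_mono)
    qed
    finally have "m * \<bar>(x - y) \<bullet> b\<bar> \<le> B * (\<Sum>c\<in>Basis - {b}. \<bar>(x - y) \<bullet> c\<bar>)"
      by (simp add: sum_distrib_left)
    then show "\<bar>(x - y) \<bullet> b\<bar> \<le> B / m * (\<Sum>c\<in>Basis - {b}. \<bar>(x - y) \<bullet> c\<bar>)"
      using \<open>m > 0\<close> by (simp add: field_simps)
  qed
qed

text \<open>A criterion for finite \<open>n\<close>-dimensional measure in terms of finite covers
  and real numbers. The bound \<open>C\<close> is chosen before \<open>\<delta>\<close>, and the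
  property passes to finite unions, so on a compact set it can be checked locally.\<close>

definition bounded_covering_sums :: "nat \<Rightarrow> 'a::metric_space set \<Rightarrow> bool" where
  "bounded_covering_sums n S \<longleftrightarrow> (\<exists>C. \<forall>\<delta>>0. \<exists>\<C>. finite \<C> \<and> S \<subseteq> \<Union>\<C> \<and>
     (\<forall>X\<in>\<C>. bounded X \<and> diameter X \<le> \<delta>) \<and> (\<Sum>X\<in>\<C>. diameter X ^ n) \<le> C)"

lemma bounded_covering_sums_empty: "bounded_covering_sums n {}"
  unfolding bounded_covering_sums_def by (intro exI[of _ 0] allI impI exI[of _ "{}"]) auto

lemma bounded_covering_sums_Un:
  assumes "bounded_covering_sums n S" "bounded_covering_sums n T"
  shows "bounded_covering_sums n (S \<union> T)"
proof -
  from assms obtain C D where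
    C: "\<And>\<delta>. \<delta> > 0 \<Longrightarrow> \<exists>\<C>. finite \<C> \<and> S \<subseteq> \<Union>\<C> \<and>
     (\<forall>X\<in>\<C>. bounded X \<and> diameter X \<le> \<delta>) \<and> (\<Sum>X\<in>\<C>. diameter X ^ n) \<le> C"
    and D: "\<And>\<delta>. \<delta> > 0 \<Longrightarrow> \<exists>\<C>. finite \<C> \<and> T \<subseteq> \<Union>\<C> \<and>
     (\<forall>X\<in>\<C>. bounded X \<and> diameter X \<le> \<delta>) \<and> (\<Sum>X\<in>\<C>. diameter X ^ n) \<le> D"
    unfolding bounded_covering_sums_def by blast
  show ?thesis
    unfolding bounded_covering_sums_def
  proof (intro exI[of _ "C + D"] allI impI)
    fix \<delta> :: real assume "\<delta> > 0"
    obtain \<C> where \<C>: "finite \<C>" "S \<subseteq> \<Union>\<C>" "\<And>X. X\<in>\<C> \<Longrightarrow> bounded X \<and> diameter X \<le> \<delta>"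
      "(\<Sum>X\<in>\<C>. diameter X ^ n) \<le> C" using C[OF \<open>\<delta> > 0\<close>] by blast
    obtain \<D> where \<D>: "finite \<D>" "T \<subseteq> \<Union>\<D>" "\<And>X. X\<in>\<D> \<Longrightarrow> bounded X \<and> diameter X \<le> \<delta>"
      "(\<Sum>X\<in>\<D>. diameter X ^ n) \<le> D" using D[OF \<open>\<delta> > 0\<close>] by blast
    have nn: "0 \<le> (\<Sum>X\<in>\<C> \<inter> \<D>. diameter X ^ n)"
      using \<C>(3) by (intro sum_nonneg zero_le_power diameter_ge_0) auto
    have "(\<Sum>X\<in>\<C> \<union> \<D>. diameter X ^ n) \<le> C + D"
      using sum.union_inter[OF \<C>(1) \<D>(1), of "\<lambda>X. diameter X ^ n"] nn \<C>(4) \<D>(4) by linarith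
    then show "\<exists>\<C>. finite \<C> \<and> S \<union> T \<subseteq> \<Union>\<C> \<and>
     (\<forall>X\<in>\<C>. bounded X \<and> diameter X \<le> \<delta>) \<and> (\<Sum>X\<in>\<C>. diameter X ^ n) \<le> C + D"
      using \<C> \<D> by (intro exI[of _ "\<C> \<union> \<D>"]) auto
  qed
qed

lemma bounded_covering_sums_UN:
  assumes "finite I" "\<And>i. i \<in> I \<Longrightarrow> bounded_covering_sums n (S i)"
  shows "bounded_covering_sums n (\<Union>i\<in>I. S i)"
  using assms
  by (induction rule: finite_induct) (auto simp: bounded_covering_sums_empty bounded_covering_sums_Un)

lemma bounded_covering_sums_imp_hausdorff_finite:
  fixes S :: "'a::euclidean_space set"
  assumes "n \<ge> 1" "bounded_covering_sums n S"
  shows "hausdorff_measure n S < \<infinity>"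
proof -
  obtain C where
    C: "\<And>\<delta>. \<delta> > 0 \<Longrightarrow> \<exists>\<C>. finite \<C> \<and> S \<subseteq> \<Union>\<C> \<and>
     (\<forall>X\<in>\<C>. bounded X \<and> diameter X \<le> \<delta>) \<and> (\<Sum>X\<in>\<C>. diameter X ^ n) \<le> C"
    using assms(2) unfolding bounded_covering_sums_def by blast
  have "hausdorff_pre n \<delta> S \<le> ennreal (unit_ball_vol n / 2 ^ n * C)" if "\<delta> > 0" for \<delta>
  proof -
    obtain \<C> where \<C>: "finite \<C>" "S \<subseteq> \<Union>\<C>" "\<And>X. X\<in>\<C> \<Longrightarrow> bounded X \<and> diameter X \<le> \<delta>"
      "(\<Sum>X\<in>\<C>. diameter X ^ n) \<le> C" using C[OF \<open>\<delta> > 0\<close>] by blast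
    obtain h where h: "bij_betw h {..<card \<C>} \<C>"
      using ex_bij_betw_nat_finite[OF \<C>(1)] by (auto simp: atLeast0LessThan)
    \<comment> \<open>The finite cover becomes a sequence by padding with empty sets. Their diameter
      is 0 and \<open>n \<ge> 1\<close>, so the padded terms vanish and the series is a finite
      sum.\<close>
    define E where "E = (\<lambda>i. if i < card \<C> then h i else {})"
    have hmem: "h i \<in> \<C>" if "i < card \<C>" for i
      using h that by (auto simp: bij_betw_def)
    have nn: "0 \<le> diameter (h i)" if "i < card \<C>" for i
      using \<C>(3)[OF hmem[OF that]] diameter_ge_0 by blast
    have "\<Union>\<C> = (\<Union>i. E i)"
      using h by (auto simp: E_def bij_betw_def split: if_splits)
    moreover have "bounded (E i) \<and> diameter (E i) \<le> \<delta>" for i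
      using \<C>(3)[OF hmem[of i]] \<open>\<delta> > 0\<close> by (auto simp: E_def)
    ultimately have "hausdorff_pre n \<delta> S \<le>
        (\<Sum>i. ennreal (unit_ball_vol (real n) * (diameter (E i) / 2) ^ n))"
      unfolding hausdorff_pre_def using \<C>(2) by (intro INF_lower) auto
    also have "\<dots> = (\<Sum>i<card \<C>. ennreal (unit_ball_vol (real n) * (diameter (E i) / 2) ^ n))"
      using \<open>n \<ge> 1\<close> by (intro suminf_finite) (auto simp: E_def)
    also have "\<dots> = ennreal (\<Sum>i<card \<C>. unit_ball_vol (real n) * (diameter (h i) / 2) ^ n)"
      using nn by (subst sum_ennreal[symmetric]) (auto simp: E_def)
    also have "(\<Sum>i<card \<C>. unit_ball_vol (real n) * (diameter (h i) / 2) ^ n)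
      = (\<Sum>X\<in>\<C>. unit_ball_vol (real n) * (diameter X / 2) ^ n)"
      by (rule sum.reindex_bij_betw[OF h])
    also have "\<dots> = unit_ball_vol n / 2 ^ n * (\<Sum>X\<in>\<C>. diameter X ^ n)"
      by (simp add: sum_distrib_left power_divide)
    also have "ennreal \<dots> \<le> ennreal (unit_ball_vol n / 2 ^ n * C)"
      using \<C>(4) by (intro ennreal_leI mult_left_mono) auto
    finally show ?thesis .
  qed
  then have "hausdorff_measure n S \<le> ennreal (unit_ball_vol n / 2 ^ n * C)"
    unfolding hausdorff_measure_def by (intro SUP_least) auto
  then show ?thesis
    using ennreal_less_top order_le_less_trans by (metis infinity_ennreal_def)
qed

text \<open>Cut the space of the \<open>n\<close> coordinates other than \<open>b\<close> into cubes
  of side \<open>1 / k\<close>. By the cone inequality the part of \<open>S\<close> over one cube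
  has diameter at most \<open>A / k\<close>, and about \<open>k ^ n\<close> cubes are needed, so the
  powers of \<open>k\<close> cancel in the covering sum.\<close>

lemma cone_condition_imp_bounded_covering_sums:
  fixes S :: "'a::euclidean_space set"
  assumes "b \<in> Basis" "bounded S" "L \<ge> 0"
    and cone: "\<And>x y. x \<in> S \<Longrightarrow> y \<in> S \<Longrightarrow>
       \<bar>(x - y) \<bullet> b\<bar> \<le> L * (\<Sum>c\<in>Basis - {b}. \<bar>(x - y) \<bullet> c\<bar>)"
  shows "bounded_covering_sums (DIM('a) - 1) S"
proof -
  define n where "n = DIM('a) - 1"
  obtain R0 where R0: "\<And>x. x \<in> S \<Longrightarrow> norm x \<le> R0"
    using \<open>bounded S\<close> unfolding bounded_iff by blast
  define R where "R = nat \<lceil>R0\<rceil> + 1"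
  have R: "norm x \<le> real R" if "x \<in> S" for x
    using R0[OF that] unfolding R_def by linarith
  have card: "card (Basis - {b} :: 'a set) = n"
    using \<open>b \<in> Basis\<close> by (simp add: n_def)
  define A where "A = (1 + L) * real n"
  have "A \<ge> 0" using \<open>L \<ge> 0\<close> by (simp add: A_def)
  show ?thesis
    unfolding bounded_covering_sums_def n_def[symmetric]
  proof (intro exI[of _ "(3 * real R * A) ^ n"] allI impI)
    fix \<delta> :: real assume "\<delta> > 0"
    define k where "k = nat \<lceil>A / \<delta>\<rceil> + 1"
    have "k \<ge> 1" by (simp add: k_def)
    have "A / \<delta> \<le> real k" unfolding k_def by linarith
    then have Ak: "A / real k \<le> \<delta>" using \<open>\<delta> > 0\<close> \<open>k \<ge> 1\<close> by (simp add: field_simps)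
    define F where "F = (\<lambda>x::'a. \<lambda>c\<in>Basis - {b}. \<lfloor>real k * (x \<bullet> c)\<rfloor>)"
    define fib where "fib = (\<lambda>v. {x \<in> S. F x = v})"
    define N where "N = int (k * R)"
    define I where "I = (Basis - {b} :: 'a set) \<rightarrow>\<^sub>E {-N..N}"
    have "finite I" unfolding I_def by (intro finite_PiE) auto
    have cardI: "real (card I) \<le> (3 * real R * real k) ^ n"
    proof -
      have "card I = card {-N..N} ^ n"
        unfolding I_def by (simp add: card_PiE card)
      moreover have "real (card {-N..N}) \<le> 3 * real R * real k"
      proof -
        \<comment> \<open>The summands 1 in \<open>k\<close> and \<open>R\<close> serve here: they
          make \<open>2 * (k * R) + 1\<close> at most \<open>3 * (k * R)\<close>.\<close>
        have "k * R \<ge> 1" using \<open>k \<ge> 1\<close> unfolding R_def by simp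
        moreover have "card {-N..N} = 2 * (k * R) + 1" unfolding N_def card_atLeastAtMost_int by linarith
        ultimately have "card {-N..N} \<le> 3 * (k * R)" by linarith
        then have "real (card {-N..N}) \<le> real (3 * (k * R))" by (rule of_nat_mono)
        then show ?thesis by (simp add: mult_ac)
      qed
      ultimately show ?thesis by (simp add: power_mono)
    qed
    have FI: "F x \<in> I" if "x \<in> S" for x
    proof -
      have "\<lfloor>real k * (x \<bullet> c)\<rfloor> \<in> {-N..N}" if c: "c \<in> Basis" for c
      proof -
        have "\<bar>x \<bullet> c\<bar> \<le> real R" using Basis_le_norm[OF c, of x] R[OF \<open>x \<in> S\<close>] by linarith
        then have "\<bar>real k * (x \<bullet> c)\<bar> \<le> real k * real R"
          by (simp add: abs_mult mult_left_mono)
        then have "\<bar>real k * (x \<bullet> c)\<bar> \<le> of_int N" by (simp add: N_def)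
        then show ?thesis by (simp add: abs_le_iff) linarith
      qed
      then show ?thesis by (auto simp: I_def F_def)
    qed
    have dist: "norm (x - y) \<le> A / real k" if "x \<in> fib v" "y \<in> fib v" for x y v
    proof -
      have xy: "x \<in> S" "y \<in> S" "F x = F y" using that by (auto simp: fib_def)
      have co: "\<bar>(x - y) \<bullet> c\<bar> \<le> 1 / real k" if "c \<in> Basis - {b}" for c
      proof -
        have "\<lfloor>real k * (x \<bullet> c)\<rfloor> = \<lfloor>real k * (y \<bullet> c)\<rfloor>"
          using fun_cong[OF xy(3), of c] that by (simp add: F_def)
        then have "\<bar>real k * (x \<bullet> c) - real k * (y \<bullet> c)\<bar> \<le> 1" by linarith
        then have "real k * \<bar>(x - y) \<bullet> c\<bar> \<le> 1"
          by (metis abs_mult abs_of_nat inner_diff_left right_diff_distrib)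
        then show ?thesis using \<open>k \<ge> 1\<close> by (simp add: field_simps)
      qed
      have s: "(\<Sum>c\<in>Basis - {b}. \<bar>(x - y) \<bullet> c\<bar>) \<le> real n * (1 / real k)"
        using sum_bounded_above[of "Basis - {b}" "\<lambda>c. \<bar>(x - y) \<bullet> c\<bar>" "1 / real k"] co card by simp
      have "norm (x - y) \<le> (\<Sum>c\<in>Basis. \<bar>(x - y) \<bullet> c\<bar>)" by (rule norm_le_l1)
      also have "\<dots> = \<bar>(x - y) \<bullet> b\<bar> + (\<Sum>c\<in>Basis - {b}. \<bar>(x - y) \<bullet> c\<bar>)"
        using \<open>b \<in> Basis\<close> by (simp add: sum.remove)
      also have "\<dots> \<le> (1 + L) * (\<Sum>c\<in>Basis - {b}. \<bar>(x - y) \<bullet> c\<bar>)"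
        using cone[OF xy(1,2)] by (simp add: algebra_simps)
      also have "\<dots> \<le> (1 + L) * (real n * (1 / real k))"
        using s \<open>L \<ge> 0\<close> by (intro mult_left_mono) auto
      finally show ?thesis by (simp add: A_def)
    qed
    have bd: "bounded (fib v)" for v
      using \<open>bounded S\<close> by (rule bounded_subset) (auto simp: fib_def)
    have dia: "diameter (fib v) \<le> A / real k" for v
      using dist \<open>A \<ge> 0\<close> by (intro diameter_le) auto
    have "(\<Sum>X\<in>fib ` I. diameter X ^ n) \<le> real (card (fib ` I)) * (A / real k) ^ n"
      using bd dia by (intro sum_bounded_above) (auto intro!: power_mono diameter_ge_0)
    also have "\<dots> \<le> real (card I) * (A / real k) ^ n"
      using card_image_le[OF \<open>finite I\<close>, of fib] \<open>A \<ge> 0\<close> by (intro mult_right_mono) auto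
    also have "\<dots> \<le> (3 * real R * real k) ^ n * (A / real k) ^ n"
      using cardI \<open>A \<ge> 0\<close> by (intro mult_right_mono) auto
    also have "\<dots> = (3 * real R * A) ^ n"
    proof -
      have "3 * real R * real k * (A / real k) = 3 * real R * A" using \<open>k \<ge> 1\<close> by simp
      then show ?thesis by (metis power_mult_distrib)
    qed
    finally have "(\<Sum>X\<in>fib ` I. diameter X ^ n) \<le> (3 * real R * A) ^ n" .
    moreover have "S \<subseteq> \<Union>(fib ` I)" using FI by (auto simp: fib_def)
    ultimately show "\<exists>\<C>. finite \<C> \<and> S \<subseteq> \<Union>\<C> \<and>
     (\<forall>X\<in>\<C>. bounded X \<and> diameter X \<le> \<delta>) \<and> (\<Sum>X\<in>\<C>. diameter X ^ n) \<le> (3 * real R * A) ^ n"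
      using \<open>finite I\<close> bd order_trans[OF dia Ak] by (intro exI[of _ "fib ` I"]) auto
  qed
qed

text \<open>Finiteness gives content to the final estimate, since \<open>enn2real\<close> sends
  infinity to 0. The cone condition holds in a ball around each point, and finitely many such balls
  cover \<open>M\<close>.\<close>

lemma closed_hypersurface_hausdorff_finite:
  fixes M :: "'a::euclidean_space set"
  assumes "DIM('a) \<ge> 2" and "closed_hypersurface M"
  shows "hausdorff_measure (DIM('a) - 1) M < \<infinity>"
proof (rule bounded_covering_sums_imp_hausdorff_finite)
  show "1 \<le> DIM('a) - 1" using assms(1) by simp
  have "\<exists>e>0. bounded_covering_sums (DIM('a) - 1) (M \<inter> ball p e)" if "p \<in> M" for p
  proof -
    have "\<exists>U f. open U \<and> p \<in> U \<and> smooth_on U f \<and>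
        (\<forall>x\<in>U. frechet_derivative f (at x) \<noteq> (\<lambda>v. 0)) \<and> M \<inter> U = {x\<in>U. f x = 0}"
      using assms(2) \<open>p \<in> M\<close> unfolding closed_hypersurface_def by simp
    then obtain U f where U: "open U" "p \<in> U" "smooth_on U f"
      and nz: "\<forall>x\<in>U. frechet_derivative f (at x) \<noteq> (\<lambda>v. 0)"
      and M: "M \<inter> U = {x\<in>U. f x = 0}"
      by (elim exE conjE)
    have diff: "\<And>x. x \<in> U \<Longrightarrow> f differentiable (at x)"
      and sm: "\<And>b. b \<in> Basis \<Longrightarrow> smooth_on U (\<lambda>x. frechet_derivative f (at x) b)"
      using smooth_on.cases[OF U(3)] by blast+
    have cont: "isCont (\<lambda>x. frechet_derivative f (at x) b) p" if "b \<in> Basis" for b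
    proof -
      \<comment> \<open>Unfolding the coinductive \<open>smooth_on\<close> a second time: the
        partial derivatives are smooth themselves, hence differentiable and continuous.\<close>
      have "(\<lambda>x. frechet_derivative f (at x) b) differentiable (at p)"
        using smooth_on.cases[OF sm[OF that]] \<open>p \<in> U\<close> by blast
      then show ?thesis by (rule differentiable_imp_continuous_within)
    qed
    obtain e L b where *: "e > 0" "L \<ge> 0" "b \<in> Basis" "ball p e \<subseteq> U"
      "\<And>x y. x \<in> ball p e \<Longrightarrow> y \<in> ball p e \<Longrightarrow> f x = f y \<Longrightarrow>
       \<bar>(x - y) \<bullet> b\<bar> \<le> L * (\<Sum>c\<in>Basis - {b}. \<bar>(x - y) \<bullet> c\<bar>)"
      by (rule level_set_cone_condition[OF U(1,2) diff cont bspec[OF nz U(2)]]) blast+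
    have "f x = 0" if "x \<in> M \<inter> ball p e" for x
      using that M *(4) by blast
    then have "bounded_covering_sums (DIM('a) - 1) (M \<inter> ball p e)"
      using * by (intro cone_condition_imp_bounded_covering_sums[of b _ L]) auto
    then show ?thesis using \<open>e > 0\<close> by blast
  qed
  then obtain e where e: "\<And>p. p \<in> M \<Longrightarrow> e p > 0"
    "\<And>p. p \<in> M \<Longrightarrow> bounded_covering_sums (DIM('a) - 1) (M \<inter> ball p (e p))"
    by metis
  have "compact M" using assms(2) by (simp add: closed_hypersurface_def)
  then obtain P where P: "P \<subseteq> M" "finite P" "M \<subseteq> (\<Union>p\<in>P. ball p (e p))"
    using compactE_image[of M M "\<lambda>p. ball p (e p)"] e(1)
    by (metis (no_types, lifting) UN_I centre_in_ball open_ball subsetI)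
  have "bounded_covering_sums (DIM('a) - 1) (\<Union>p\<in>P. M \<inter> ball p (e p))"
    by (rule bounded_covering_sums_UN) (use P e(2) in auto)
  moreover have "(\<Union>p\<in>P. M \<inter> ball p (e p)) = M" using P by blast
  ultimately show "bounded_covering_sums (DIM('a) - 1) M" by simp
qed

section \<open>Pushing onto the dual skeleton\<close>

text \<open>\<open>polyhedron_dim_le\<close> puts no condition on how the simplices meet, so each
  polytope is triangulated on its own and the triangulations are collected.\<close>

lemma polyhedron_dim_le_UN_polytopes:
  fixes F :: "'i \<Rightarrow> 'a::euclidean_space set"
  assumes "finite I" and poly: "\<And>i. i \<in> I \<Longrightarrow> polytope (F i)"
    and dim: "\<And>i. i \<in> I \<Longrightarrow> aff_dim (F i) \<le> int k"
  shows "polyhedron_dim_le k (\<Union>i\<in>I. F i)"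
proof -
  have "\<exists>\<T>. finite \<T> \<and> (\<forall>S\<in>\<T>. \<exists>d. d \<le> int k \<and> d simplex S) \<and> \<Union>\<T> = F i" if i: "i \<in> I" for i
  proof -
    obtain \<T> where \<T>: "simplicial_complex \<T>" "\<And>K. K \<in> \<T> \<Longrightarrow> aff_dim K \<le> int k" "\<Union>\<T> = \<Union>{F i}"
      by (rule simplicial_subdivision_of_cell_complex_lowdim[of "{F i}" "int k"])
         (use poly[OF i] dim[OF i] in \<open>auto intro!: face_of_refl polytope_imp_convex\<close>)
    have "\<exists>d. d \<le> int k \<and> d simplex S" if "S \<in> \<T>" for S
      using \<T>(1,2) that aff_dim_simplex unfolding simplicial_complex_def by metis
    then show ?thesis
      using \<T> unfolding simplicial_complex_def by (intro exI[of _ \<T>]) auto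
  qed
  then obtain T where T: "\<And>i. i \<in> I \<Longrightarrow> finite (T i)"
    "\<And>i S. i \<in> I \<Longrightarrow> S \<in> T i \<Longrightarrow> \<exists>d. d \<le> int k \<and> d simplex S" "\<And>i. i \<in> I \<Longrightarrow> \<Union>(T i) = F i"
    by metis
  show ?thesis
    unfolding polyhedron_dim_le_def
  proof (intro exI[of _ "\<Union>i\<in>I. T i"] conjI)
    show "finite (\<Union>i\<in>I. T i)" using \<open>finite I\<close> T(1) by auto
    show "\<forall>S\<in>\<Union>i\<in>I. T i. \<exists>d. d \<le> int k \<and> d simplex S" using T(2) by auto
    show "(\<Union>i\<in>I. F i) = \<Union>(\<Union>i\<in>I. T i)" using T(3) by blast
  qed
qed

lemma aff_dim_two_coordinates_fixed:
  fixes b c :: "'a::euclidean_space"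
  assumes "b \<in> Basis" "c \<in> Basis" "b \<noteq> c"
  shows "aff_dim {x. b \<bullet> x = \<beta> \<and> c \<bullet> x = \<gamma>} \<le> int (DIM('a) - 2)"
proof -
  have D: "DIM('a) \<ge> 2"
    using card_mono[of "Basis :: 'a set" "{b, c}"] assms by auto
  let ?H = "{x. b \<bullet> x = \<beta>}"
  \<comment> \<open>A point of the first hyperplane off the second: intersecting with the second
    therefore lowers the dimension once more.\<close>
  let ?q = "\<beta> *\<^sub>R b + (\<gamma> + 1) *\<^sub>R c"
  have "b \<bullet> ?q = \<beta>" "c \<bullet> ?q = \<gamma> + 1"
    using assms by (auto simp: inner_add_right inner_Basis)
  then have "\<not> ?H \<subseteq> {x. c \<bullet> x = \<gamma>}" by (auto intro!: exI[of _ ?q])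
  moreover have "aff_dim ?H = int DIM('a) - 1"
    using assms by (subst aff_dim_hyperplane) auto
  moreover have "{x. b \<bullet> x = \<beta> \<and> c \<bullet> x = \<gamma>} = ?H \<inter> {x. c \<bullet> x = \<gamma>}" by auto
  ultimately show ?thesis
    using D by (simp add: aff_dim_affine_Int_hyperplane affine_hyperplane of_nat_diff)
qed

section \<open>Expansion of the real line around the integers\<close>

definition cutoff :: "real \<Rightarrow> real" where
  "cutoff y = max (-1/2) (min (1/2) y)"

lemma continuous_on_cutoff [continuous_intros]:
  "continuous_on S f \<Longrightarrow> continuous_on S (\<lambda>x. cutoff (f x))"
  unfolding cutoff_def by (intro continuous_intros)

definition integer_dist :: "real \<Rightarrow> real" where
  "integer_dist u = \<bar>u - of_int (round u)\<bar>"

lemma integer_dist_le: "integer_dist u \<le> 1/2"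
  unfolding integer_dist_def using of_int_round_abs_le[of u] by (simp add: abs_minus_commute)

lemma integer_dist_nonneg: "integer_dist u \<ge> 0"
  by (simp add: integer_dist_def)

lemma integer_dist_pos: "u \<notin> \<int> \<Longrightarrow> integer_dist u > 0"
  by (metis Ints_of_int eq_iff_diff_eq_0 integer_dist_def zero_less_abs_iff)

text \<open>Although \<open>round\<close> jumps, the distance does not: \<open>round v\<close> is
  one of the integers against which \<open>round u\<close> is the closest to
  \<open>u\<close>.\<close>

lemma integer_dist_lipschitz: "\<bar>integer_dist u - integer_dist v\<bar> \<le> \<bar>u - v\<bar>"
proof -
  have "integer_dist u \<le> \<bar>u - v\<bar> + integer_dist v" for u v
    using round_diff_minimal[of u "round v"] unfolding integer_dist_def by linarith
  from this[of u v] this[of v u] show ?thesis by linarith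
qed

lemma continuous_on_integer_dist [continuous_intros]:
  assumes "continuous_on S f"
  shows "continuous_on S (\<lambda>x. integer_dist (f x))"
proof -
  have "continuous_on UNIV integer_dist"
    unfolding continuous_on_iff dist_real_def
    using integer_dist_lipschitz order_le_less_trans by blast
  then show ?thesis using continuous_on_compose2[OF _ assms] by blast
qed

text \<open>Expands the window of radius \<open>m\<close> around each integer to the whole unit interval around it
  and collapses the rest to half-integers; writing it as a sum makes continuity evident.\<close>

definition expand :: "int \<Rightarrow> real \<Rightarrow> real \<Rightarrow> real" where
  "expand N m u = (\<Sum>j\<in>{-N..N}. cutoff ((u - of_int j) / (2 * m)))"

text \<open>With \<open>k = round u\<close>, the summands for \<open>j < k\<close> have saturated at
  \<open>1/2\<close> and those for \<open>j > k\<close> at \<open>-1/2\<close>, because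
  \<open>m \<le> 1/2\<close>. Counting them gives \<open>(k + N) / 2 - (N - k) / 2 = k\<close>,
  which leaves the summand of \<open>k\<close> itself.\<close>

lemma expand_eq:
  assumes "\<bar>u\<bar> \<le> of_int N" "0 < m" "m \<le> 1/2"
  shows "expand N m u = of_int (round u) + cutoff ((u - of_int (round u)) / (2 * m))"
proof -
  define k where "k = round u"
  have k: "\<bar>u - of_int k\<bar> \<le> 1/2"
    unfolding k_def using of_int_round_abs_le[of u] by (simp add: abs_minus_commute)
  have "-N \<le> k" "k \<le> N"
    using round_mono[of "of_int (-N)" u] round_mono[of u "of_int N"] assms(1)
    unfolding k_def round_of_int by auto
  have hi: "cutoff ((u - of_int j) / (2 * m)) = 1/2" if "j < k" for j
  proof -
    have "of_int j \<le> (of_int k - 1 :: real)" using that by linarith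
    then have "u - of_int j \<ge> m" using k assms by linarith
    then show ?thesis using \<open>0 < m\<close> by (simp add: cutoff_def field_simps)
  qed
  have lo: "cutoff ((u - of_int j) / (2 * m)) = -1/2" if "k < j" for j
  proof -
    have "of_int j \<ge> (of_int k + 1 :: real)" using that by linarith
    then have "u - of_int j \<le> -m" using k assms by linarith
    then have "(u - of_int j) / (2 * m) \<le> -1/2" using \<open>0 < m\<close> by (simp add: field_simps)
    then show ?thesis by (simp add: cutoff_def)
  qed
  have "{-N..N} = {-N..<k} \<union> ({k} \<union> {k<..N})"
    using \<open>-N \<le> k\<close> \<open>k \<le> N\<close> by auto
  then have "expand N m u = (\<Sum>j\<in>{-N..<k} \<union> ({k} \<union> {k<..N}). cutoff ((u - of_int j) / (2 * m)))"
    by (simp add: expand_def)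
  also have "\<dots> = (\<Sum>j\<in>{-N..<k}. cutoff ((u - of_int j) / (2 * m))) +
     (cutoff ((u - of_int k) / (2 * m)) + (\<Sum>j\<in>{k<..N}. cutoff ((u - of_int j) / (2 * m))))"
    by (subst sum.union_disjoint; auto)+
  also have "(\<Sum>j\<in>{-N..<k}. cutoff ((u - of_int j) / (2 * m))) = (\<Sum>j\<in>{-N..<k}. 1/2)"
    by (intro sum.cong) (auto simp: hi)
  also have "\<dots> = of_int (k + N) / 2" using \<open>-N \<le> k\<close> by simp
  also have "(\<Sum>j\<in>{k<..N}. cutoff ((u - of_int j) / (2 * m))) = (\<Sum>j\<in>{k<..N}. -1/2)"
    by (intro sum.cong) (auto simp: lo)
  also have "\<dots> = - of_int (N - k) / 2" using \<open>k \<le> N\<close> by (simp add: field_simps)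
  finally show ?thesis by (simp add: k_def field_simps)
qed

text \<open>Relative to the nearest integer, \<open>u\<close> and its image lie on the same side and
  both within \<open>1/2\<close>, so they differ by at most \<open>1/2\<close>. Since
  \<open>2 * m \<le> 1\<close>, points move away from the integer before the cutoff acts.\<close>

lemma expand_close:
  assumes "\<bar>u\<bar> \<le> of_int N" "0 < m" "m \<le> 1/2"
  shows "\<bar>u - expand N m u\<bar> \<le> 1/2"
proof -
  define v where "v = u - of_int (round u)"
  have v: "\<bar>v\<bar> \<le> 1/2"
    unfolding v_def using of_int_round_abs_le[of u] by (simp add: abs_minus_commute)
  have "\<bar>v - cutoff (v / (2 * m))\<bar> \<le> 1/2"
  proof (cases "v \<ge> 0")
    case True
    then have "v * (2 * m) \<le> v * 1" using assms by (intro mult_left_mono) auto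
    then have "v / (2 * m) \<ge> v" using assms by (simp add: field_simps)
    then show ?thesis using v True by (auto simp: cutoff_def)
  next
    case False
    then have "v * 1 \<le> v * (2 * m)" using assms by (intro mult_left_mono_neg) auto
    then have "v / (2 * m) \<le> v" using assms by (simp add: field_simps)
    then show ?thesis using v False by (auto simp: cutoff_def)
  qed
  moreover have "u - expand N m u = v - cutoff (v / (2 * m))"
    by (simp add: expand_eq[OF assms] v_def)
  ultimately show ?thesis by simp
qed

text \<open>Outside the window the cutoff has saturated. Saturation from below gives the index
  \<open>round u - 1\<close>, which is why the range starts at \<open>-N - 1\<close>.\<close>

lemma expand_half_integer:
  assumes "\<bar>u\<bar> \<le> of_int N" "0 < m" "m \<le> integer_dist u"
  obtains p where "p \<in> {-N-1..N}" "expand N m u = of_int p + 1/2"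
proof -
  have m: "m \<le> 1/2" using integer_dist_le assms(3) by (rule order_trans[rotated])
  define v where "v = u - of_int (round u)"
  have "-N \<le> round u" "round u \<le> N"
    using round_mono[of "of_int (-N)" u] round_mono[of u "of_int N"] assms(1)
    unfolding round_of_int by auto
  have e: "expand N m u = of_int (round u) + cutoff (v / (2 * m))"
    by (simp add: expand_eq[OF assms(1,2) m] v_def)
  consider "v \<ge> m" | "v \<le> -m" using assms(3) unfolding integer_dist_def v_def by linarith
  then show thesis
  proof cases
    case 1
    then have "cutoff (v / (2 * m)) = 1/2" using \<open>0 < m\<close> by (simp add: cutoff_def field_simps)
    then show ?thesis using that[of "round u"] e \<open>-N \<le> round u\<close> \<open>round u \<le> N\<close> by auto
  next
    case 2
    then have "v / (2 * m) \<le> -1/2" using \<open>0 < m\<close> by (simp add: field_simps)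
    then have "cutoff (v / (2 * m)) = -1/2" by (simp add: cutoff_def)
    then show ?thesis using that[of "round u - 1"] e \<open>-N \<le> round u\<close> \<open>round u \<le> N\<close> by auto
  qed
qed

text \<open>Using \<open>avoid\<close> twice, the second time with the direction just found, gives
  two noninteger coordinates at every point. Compactness makes this uniform: the sum
  \<open>g\<close> of all products of two distances has a positive minimum, some product is then
  bounded below, and both of its factors are at least the product since neither exceeds 1.\<close>

lemma uniformly_two_noninteger_coordinates:
  fixes M :: "'a::euclidean_space set" and u :: "'a \<Rightarrow> 'a \<Rightarrow> real"
  assumes "compact M" "M \<noteq> {}"
    and cont: "\<And>b. b \<in> Basis \<Longrightarrow> continuous_on M (\<lambda>x. u x b)"
    and avoid: "\<And>x i. x \<in> M \<Longrightarrow> i \<in> Basis \<Longrightarrow> \<exists>b\<in>Basis - {i}. u x b \<notin> \<int>"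
  obtains m where "m > 0"
    "\<And>x. x \<in> M \<Longrightarrow> \<exists>b\<in>Basis. \<exists>c\<in>Basis - {b}. m \<le> integer_dist (u x b) \<and> m \<le> integer_dist (u x c)"
proof -
  define g where "g = (\<lambda>x. \<Sum>b\<in>Basis. \<Sum>c\<in>Basis - {b}. integer_dist (u x b) * integer_dist (u x c))"
  have "continuous_on M g"
    unfolding g_def by (intro continuous_intros cont) auto
  then obtain x0 where x0: "x0 \<in> M" "\<And>x. x \<in> M \<Longrightarrow> g x0 \<le> g x"
    using continuous_attains_inf[OF assms(1,2)] by blast
  obtain b where b: "b \<in> Basis" "u x0 b \<notin> \<int>"
    using avoid[OF x0(1)] nonempty_Basis by blast
  obtain c where c: "c \<in> Basis - {b}" "u x0 c \<notin> \<int>"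
    using avoid[OF x0(1) b(1)] by blast
  have nn: "0 \<le> integer_dist (u x b) * integer_dist (u x c)" for x b c
    by (simp add: integer_dist_nonneg)
  have "0 < integer_dist (u x0 b) * integer_dist (u x0 c)"
    using b c by (simp add: integer_dist_pos)
  also have "\<dots> \<le> (\<Sum>c\<in>Basis - {b}. integer_dist (u x0 b) * integer_dist (u x0 c))"
    using c by (intro member_le_sum nn) auto
  also have "\<dots> \<le> g x0"
    unfolding g_def using b
    by (intro member_le_sum[of b Basis "\<lambda>b. \<Sum>c\<in>Basis - {b}. integer_dist (u x0 b) * integer_dist (u x0 c)"]
          sum_nonneg nn) auto
  finally have "g x0 > 0" .
  \<comment> \<open>If every product were below \<open>m\<close>, its at most
    \<open>DIM('a) * DIM('a)\<close> terms would make \<open>g x\<close> at most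
    \<open>g x0 / 2\<close>, less than the minimum.\<close>
  define m where "m = g x0 / (2 * real DIM('a) * real DIM('a))"
  have "m > 0" using \<open>g x0 > 0\<close> by (simp add: m_def)
  show thesis
  proof (rule that[OF \<open>m > 0\<close>])
    fix x assume "x \<in> M"
    have "\<exists>b\<in>Basis. \<exists>c\<in>Basis - {b}. m \<le> integer_dist (u x b) * integer_dist (u x c)"
    proof (rule ccontr)
      assume neg: "\<not> ?thesis"
      have "(\<Sum>c\<in>Basis - {b}. integer_dist (u x b) * integer_dist (u x c)) \<le> real DIM('a) * m"
        if "b \<in> Basis" for b
      proof -
        have "(\<Sum>c\<in>Basis - {b}. integer_dist (u x b) * integer_dist (u x c))
          \<le> (\<Sum>c\<in>Basis - {b}. m)"
          using neg that by (intro sum_mono) (auto simp: not_le intro: less_imp_le)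
        also have "\<dots> \<le> (\<Sum>c\<in>(Basis::'a set). m)"
          using \<open>m > 0\<close> by (intro sum_mono2) auto
        finally show ?thesis by simp
      qed
      then have "g x \<le> real DIM('a) * (real DIM('a) * m)"
        unfolding g_def by (rule sum_bounded_above)
      also have "\<dots> = g x0 / 2" by (simp add: m_def)
      finally show False using x0(2)[OF \<open>x \<in> M\<close>] \<open>g x0 > 0\<close> by linarith
    qed
    then obtain b c where bc: "b \<in> Basis" "c \<in> Basis - {b}"
      "m \<le> integer_dist (u x b) * integer_dist (u x c)" by blast
    have "integer_dist (u x b) * integer_dist (u x c) \<le> integer_dist (u x b)"
      "integer_dist (u x b) * integer_dist (u x c) \<le> integer_dist (u x c)"
      using integer_dist_le[of "u x b"] integer_dist_le[of "u x c"]
      by (auto intro!: mult_left_le mult_left_le_one_le integer_dist_nonneg)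
    then show "\<exists>b\<in>Basis. \<exists>c\<in>Basis - {b}. m \<le> integer_dist (u x b) \<and> m \<le> integer_dist (u x c)"
      using bc by (meson order_trans)
  qed
qed

text \<open>The hypothesis \<open>avoid\<close> says that \<open>M\<close> misses every line of the
  grid through \<open>t\<close> with mesh \<open>s\<close>. Applying \<open>expand\<close> to each
  coordinate, in units of the mesh, moves it by at most \<open>s / 2\<close> and sends at least two
  coordinates to half-integers, so the image lies in the dual skeleton of codimension two.\<close>

lemma linf_approximation_avoiding_grid_lines:
  fixes M :: "'a::euclidean_space set"
  assumes "compact M" "M \<noteq> {}" "s > 0"
    and avoid: "\<And>x i. x \<in> M \<Longrightarrow> i \<in> Basis \<Longrightarrow> \<exists>b\<in>Basis - {i}. ((x - t) \<bullet> b) / s \<notin> \<int>"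
  obtains K \<phi> where "polyhedron_dim_le (DIM('a) - 2) K" "continuous_on M \<phi>" "\<phi> ` M \<subseteq> K"
    "\<And>x. x \<in> M \<Longrightarrow> infnorm (x - \<phi> x) \<le> s / 2"
proof -
  define u where "u = (\<lambda>x b. ((x - t) \<bullet> b) / s)"
  have contu: "continuous_on M (\<lambda>x. u x b)" for b
    unfolding u_def using \<open>s > 0\<close> by (intro continuous_intros) auto
  obtain m where m: "m > 0" and two: "\<And>x. x \<in> M \<Longrightarrow>
      \<exists>b\<in>Basis. \<exists>c\<in>Basis - {b}. m \<le> integer_dist (u x b) \<and> m \<le> integer_dist (u x c)"
    using uniformly_two_noninteger_coordinates[OF assms(1,2), of u] contu avoid unfolding u_def by blast
  have m2: "m \<le> 1/2"
    using \<open>M \<noteq> {}\<close> two integer_dist_le by (meson all_not_in_conv order_trans)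
  obtain R where R: "\<And>x. x \<in> M \<Longrightarrow> norm (x - t) \<le> R"
    using compact_imp_bounded[OF compact_translation_subtract[OF \<open>compact M\<close>, of t]]
    unfolding bounded_iff by auto
  define N where "N = \<lceil>R / s\<rceil>"
  have uN: "\<bar>u x b\<bar> \<le> of_int N" if "x \<in> M" "b \<in> Basis" for x b
  proof -
    have "\<bar>u x b\<bar> \<le> R / s"
      using Basis_le_norm[OF that(2), of "x - t"] R[OF that(1)] \<open>s > 0\<close>
      by (simp add: u_def divide_right_mono)
    then show ?thesis unfolding N_def by linarith
  qed
  define \<phi> where "\<phi> = (\<lambda>x. t + (\<Sum>b\<in>Basis. (s * expand N m (u x b)) *\<^sub>R b))"
  have \<phi>b: "\<phi> x \<bullet> b = t \<bullet> b + s * expand N m (u x b)" if "b \<in> Basis" for x b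
    using that by (simp add: \<phi>_def inner_add_left)
  have cont: "continuous_on M \<phi>"
    unfolding \<phi>_def expand_def using m by (intro continuous_intros contu) auto
  then have "bounded (\<phi> ` M)"
    using compact_continuous_image[OF _ \<open>compact M\<close>] compact_imp_bounded by blast
  then obtain a where a: "\<phi> ` M \<subseteq> cbox (-a) a" using bounded_subset_cbox_symmetric by blast
  define J where "J = (\<lambda>p::int. s * (of_int p + 1/2))"
  define I where "I = {(b :: 'a, c, p, q). b \<in> Basis \<and> c \<in> Basis - {b} \<and> p \<in> {-N-1..N} \<and> q \<in> {-N-1..N}}"
  \<comment> \<open>A piece of the dual skeleton, cut off by a cube containing the image of
    \<open>\<phi>\<close> so that it is a polytope; finitely many indices suffice as the grid
    coordinates on \<open>M\<close> are bounded by \<open>N\<close>.\<close>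
  define F where "F = (\<lambda>(b, c, p, q). cbox (-a) a \<inter> {x. b \<bullet> x = t \<bullet> b + J p \<and> c \<bullet> x = t \<bullet> c + J q})"
  have sub: "\<phi> x \<in> (\<Union>i\<in>I. F i)" if xM: "x \<in> M" for x
  proof -
    obtain b c where bc: "b \<in> Basis" "c \<in> Basis - {b}"
      "m \<le> integer_dist (u x b)" "m \<le> integer_dist (u x c)" using two[OF xM] by blast
    obtain p where p: "p \<in> {-N-1..N}" "expand N m (u x b) = of_int p + 1/2"
      using expand_half_integer[OF uN[OF xM bc(1)] m bc(3)] .
    obtain q where q: "q \<in> {-N-1..N}" "expand N m (u x c) = of_int q + 1/2"
      using expand_half_integer[OF uN[OF xM, of c] m bc(4)] bc(2) by blast
    have "b \<bullet> \<phi> x = t \<bullet> b + J p" "c \<bullet> \<phi> x = t \<bullet> c + J q"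
      using \<phi>b[of b x] \<phi>b[of c x] bc p q by (auto simp: J_def inner_commute[of _ "\<phi> x"])
    then have "\<phi> x \<in> F (b, c, p, q)"
      using a xM by (auto simp: F_def)
    moreover have "(b, c, p, q) \<in> I" using bc p q by (simp add: I_def)
    ultimately show ?thesis by blast
  qed
  show thesis
  proof (rule that[of "\<Union>i\<in>I. F i" \<phi>])
    show "polyhedron_dim_le (DIM('a) - 2) (\<Union>i\<in>I. F i)"
    proof (rule polyhedron_dim_le_UN_polytopes)
      have "I \<subseteq> Basis \<times> Basis \<times> {-N-1..N} \<times> {-N-1..N}" by (auto simp: I_def)
      then show "finite I" by (rule finite_subset) auto
    next
      fix i assume "i \<in> I"
      obtain b c p q where i: "i = (b, c, p, q)" by (metis surj_pair)
      have bc: "b \<in> Basis" "c \<in> Basis" "b \<noteq> c" using \<open>i \<in> I\<close> i by (auto simp: I_def)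
      have "polyhedron {x. b \<bullet> x = t \<bullet> b + J p \<and> c \<bullet> x = t \<bullet> c + J q}"
        using polyhedron_Int[OF polyhedron_hyperplane[of b "t \<bullet> b + J p"] polyhedron_hyperplane[of c "t \<bullet> c + J q"]]
        by (simp add: Collect_conj_eq)
      then show "polytope (F i)"
        unfolding i F_def by (simp add: polytope_Int_polyhedron polytope_interval)
      have "aff_dim (F i) \<le> aff_dim {x. b \<bullet> x = t \<bullet> b + J p \<and> c \<bullet> x = t \<bullet> c + J q}"
        unfolding i F_def by (intro aff_dim_subset) auto
      also have "\<dots> \<le> int (DIM('a) - 2)" by (rule aff_dim_two_coordinates_fixed[OF bc])
      finally show "aff_dim (F i) \<le> int (DIM('a) - 2)" .
    qed
    show "continuous_on M \<phi>" by (rule cont)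
    show "\<phi> ` M \<subseteq> (\<Union>i\<in>I. F i)" using sub by blast
    fix x assume "x \<in> M"
    have "\<bar>(x - \<phi> x) \<bullet> b\<bar> \<le> s / 2" if "b \<in> Basis" for b
    proof -
      have "(x - \<phi> x) \<bullet> b = s * (u x b - expand N m (u x b))"
        using \<open>s > 0\<close> by (simp add: inner_diff_left \<phi>b[OF that] u_def field_simps)
      then have "\<bar>(x - \<phi> x) \<bullet> b\<bar> = s * \<bar>u x b - expand N m (u x b)\<bar>"
        using \<open>s > 0\<close> by (simp add: abs_mult)
      also have "\<dots> \<le> s * (1/2)"
        using expand_close[OF uN[OF \<open>x \<in> M\<close> that] m m2] \<open>s > 0\<close> by (intro mult_left_mono) auto
      finally show ?thesis by simp
    qed
    then show "infnorm (x - \<phi> x) \<le> s / 2"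
      unfolding infnorm_Max by (intro Max.boundedI) auto
  qed
qed

section \<open>Grids in general position\<close>

text \<open>The centre is the midpoint of two points realizing the diameter \<open>d\<close>. The
  formula for the median of a triangle bounds the squared distance to it by
  \<open>d\<^sup>2 - d\<^sup>2 / 4\<close>, in every dimension.\<close>

lemma bounded_subset_cball_diameter:
  fixes C :: "'a::real_inner set"
  assumes "bounded C" "compact (closure C)"
  shows "\<exists>c. C \<subseteq> cball c (sqrt 3 / 2 * diameter C)"
proof (cases "C = {}")
  case False
  define d where "d = diameter C"
  have "d \<ge> 0" unfolding d_def by (rule diameter_ge_0[OF assms(1)])
  obtain x y where xy: "x \<in> closure C" "y \<in> closure C" "dist x y = d"
    using diameter_compact_attained[OF assms(2)] False diameter_closure[OF assms(1)]
    unfolding d_def by auto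
  have "norm (z - (1/2) *\<^sub>R (x + y)) \<le> sqrt 3 / 2 * d" if "z \<in> C" for z
  proof -
    have le: "norm (z - w) \<le> d" if "w \<in> closure C" for w
      using diameter_bounded_bound[OF compact_imp_bounded[OF assms(2)], of z w] \<open>z \<in> C\<close> that
        diameter_closure[OF assms(1)] closure_subset[of C]
      by (auto simp: d_def dist_norm)
    have "(norm (z - (1/2) *\<^sub>R (x + y)))\<^sup>2 = ((norm (z - x))\<^sup>2 + (norm (z - y))\<^sup>2) / 2 - (norm (x - y))\<^sup>2 / 4"
      unfolding power2_norm_eq_inner
      by (simp add: inner_diff inner_add inner_commute field_simps)
    also have "\<dots> \<le> (d\<^sup>2 + d\<^sup>2) / 2 - d\<^sup>2 / 4"
      using power_mono[OF le[OF xy(1)], of 2] power_mono[OF le[OF xy(2)], of 2] xy(3)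
      by (simp add: dist_norm)
    also have "\<dots> = (sqrt 3 / 2 * d)\<^sup>2" by (simp add: power_mult_distrib power_divide)
    finally show ?thesis by (rule power2_le_imp_le) (simp add: \<open>d \<ge> 0\<close>)
  qed
  then show ?thesis
    by (intro exI[of _ "(1/2) *\<^sub>R (x + y)"]) (auto simp: dist_norm norm_minus_commute d_def)
qed auto

text \<open>The source of the constant 3 in the theorem: \<open>n + 1\<close> directions, each with
  the loss \<open>sqrt 3 ^ n\<close> from replacing sets by balls. After squaring, the quotient of
  the two sides is nonincreasing from \<open>n = 6\<close> on; the smaller values are checked one by
  one.\<close>

lemma succ_mult_sqrt3_power_le: "real (n + 1) * sqrt 3 ^ n \<le> 3 * 2 ^ n"
proof -
  have step: "(n + 1)\<^sup>2 * 3 ^ n \<le> 9 * (4::nat) ^ n" if "n \<ge> 6" for n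
    using that
  proof (induction n rule: dec_induct)
    case base
    show ?case by simp
  next
    case (step n)
    have "3 * (n + 2)\<^sup>2 \<le> 4 * (n + 1)\<^sup>2"
    proof -
      have "6 * n \<le> n * n" using step.hyps(1) by simp
      then have "8 + 4 * n \<le> n * n" using step.hyps(1) by linarith
      then show ?thesis by (simp add: power2_eq_square algebra_simps)
    qed
    then have "3 * (n + 2)\<^sup>2 * 3 ^ n \<le> 4 * (n + 1)\<^sup>2 * 3 ^ n" by simp
    also have "\<dots> \<le> 4 * (9 * 4 ^ n)" using mult_le_mono2[OF step.IH, of 4] by (simp only: mult.assoc)
    finally show ?case by (simp add: mult_ac)
  qed
  have "(n + 1)\<^sup>2 * 3 ^ n \<le> 9 * (4::nat) ^ n"
  proof (cases "n \<ge> 6")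
    case False
    then have "n \<in> {0, 1, 2, 3, 4, 5}" by auto
    then show ?thesis by (auto simp: power2_eq_square)
  qed (rule step)
  then have "real ((n + 1)\<^sup>2 * 3 ^ n) \<le> real (9 * 4 ^ n)" by (rule of_nat_mono)
  moreover have "(sqrt 3 ^ n)\<^sup>2 = (3::real) ^ n" "((2::real) ^ n)\<^sup>2 = 4 ^ n"
    using power_mult[of "sqrt 3" 2 n] power_mult[of "sqrt 3" n 2] power_mult[of "2::real" 2 n]
      power_mult[of "2::real" n 2] by (simp_all add: mult.commute)
  ultimately have "(real (n + 1) * sqrt 3 ^ n)\<^sup>2 \<le> (3 * 2 ^ n)\<^sup>2"
    by (simp add: power_mult_distrib)
  then show ?thesis by (rule power2_le_imp_le) simp
qed

section \<open>Volumes of cylinders over balls\<close>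

lemma emeasure_lborel_translate:
  fixes c :: "'a::euclidean_space"
  assumes "A \<in> sets borel"
  shows "emeasure lborel {x. c + x \<in> A} = emeasure lborel A"
proof -
  have "emeasure lborel A = emeasure (distr lborel borel ((+) c)) A"
    by (simp add: lborel_distr_plus)
  also have "\<dots> = emeasure lborel ((+) c -` A \<inter> space lborel)"
    using assms by (intro emeasure_distr) auto
  finally show ?thesis by (simp add: vimage_def)
qed

text \<open>The ball of radius \<open>\<rho>\<close> about \<open>c\<close>, projected along
  \<open>i\<close> and then thickened to the height \<open>s\<close> of a period cube. The sum over
  \<open>Basis - {i}\<close> stands for the squared norm of the projection, so no space of lower
  dimension has to be introduced.\<close>

definition cylinder :: "'a::euclidean_space \<Rightarrow> real \<Rightarrow> 'a \<Rightarrow> real \<Rightarrow> 'a set" where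
  "cylinder i s c \<rho> = {x. 0 < x \<bullet> i \<and> x \<bullet> i < s \<and> (\<Sum>b\<in>Basis - {i}. ((x - c) \<bullet> b)\<^sup>2) \<le> \<rho>\<^sup>2}"

lemma cylinder_borel [measurable]: "cylinder i s c \<rho> \<in> sets borel"
  unfolding cylinder_def by measurable

text \<open>Fubini in the product of the coordinate lines: splitting off the coordinate
  \<open>i\<close> leaves a segment of length \<open>s\<close> times a ball in the remaining
  \<open>DIM('a) - 1\<close> coordinates.\<close>

lemma emeasure_cylinder_origin:
  fixes i :: "'a::euclidean_space"
  assumes "i \<in> Basis" "\<rho> > 0" "s > 0"
  shows "emeasure lborel (cylinder i s 0 \<rho>) =
    ennreal (s * (unit_ball_vol (real (DIM('a) - 1)) * \<rho> ^ (DIM('a) - 1)))"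
proof -
  interpret product_sigma_finite "\<lambda>_::'a. lborel :: real measure"
    by standard
  let ?B = "Basis - {i}"
  let ?P = "\<lambda>A. Pi\<^sub>M A (\<lambda>_::'a. lborel :: real measure)"
  let ?D = "{f. sqrt (\<Sum>b\<in>?B. (f b)\<^sup>2) \<le> \<rho>} \<inter> space (?P ?B)"
  have ins: "insert i ?B = Basis" using assms(1) by auto
  have card: "card ?B = DIM('a) - 1" using assms(1) by simp
  have coord: "(\<Sum>b\<in>Basis. f b *\<^sub>R b) \<bullet> c = f c" if "c \<in> Basis" for f and c :: 'a
    using that by simp
  define E where "E = {f. 0 < f i \<and> f i < s \<and> (\<Sum>b\<in>?B. (f b)\<^sup>2) \<le> \<rho>\<^sup>2} \<inter> space (?P Basis)"
  have [measurable]: "E \<in> sets (?P Basis)"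
    unfolding E_def using assms(1) by measurable
  have "emeasure lborel (cylinder i s 0 \<rho>) =
      emeasure (distr (?P Basis) borel (\<lambda>f. \<Sum>b\<in>Basis. f b *\<^sub>R b)) (cylinder i s 0 \<rho>)"
    by (subst lborel_eq) simp
  also have "\<dots> = emeasure (?P Basis) ((\<lambda>f. \<Sum>b\<in>Basis. f b *\<^sub>R b) -` cylinder i s 0 \<rho> \<inter> space (?P Basis))"
    by (subst emeasure_distr) auto
  also have "(\<lambda>f. \<Sum>b\<in>Basis. f b *\<^sub>R b) -` cylinder i s 0 \<rho> \<inter> space (?P Basis) = E"
    unfolding E_def cylinder_def using assms(1) by (auto simp: coord)
  also have "emeasure (?P Basis) E = (\<integral>\<^sup>+f. indicator E f \<partial>?P (insert i ?B))"
    unfolding ins by simp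
  also have "\<dots> = (\<integral>\<^sup>+x. \<integral>\<^sup>+y. indicator E (x(i := y)) \<partial>lborel \<partial>?P ?B)"
  proof (rule product_nn_integral_insert)
    show "indicator E \<in> borel_measurable (?P (insert i ?B))" unfolding ins by measurable
  qed auto
  also have "\<dots> = (\<integral>\<^sup>+x. \<integral>\<^sup>+y. indicator ?D x * indicator {0<..<s} y \<partial>lborel \<partial>?P ?B)"
  proof (intro nn_integral_cong)
    fix x y assume x: "x \<in> space (?P ?B)"
    have "x(i := y) \<in> space (?P Basis)"
      using x assms(1) by (auto simp: space_PiM PiE_def extensional_def)
    moreover have "(\<Sum>b\<in>?B. ((x(i := y)) b)\<^sup>2) = (\<Sum>b\<in>?B. (x b)\<^sup>2)"
      by (intro sum.cong) auto
    moreover have "(\<Sum>b\<in>?B. (x b)\<^sup>2) \<le> \<rho>\<^sup>2 \<longleftrightarrow> sqrt (\<Sum>b\<in>?B. (x b)\<^sup>2) \<le> \<rho>"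
      using \<open>\<rho> > 0\<close> by (simp add: real_sqrt_le_iff' sum_nonneg)
    ultimately show "indicator E (x(i := y)) = (indicator ?D x * indicator {0<..<s} y :: ennreal)"
      using x by (auto simp: E_def indicator_def)
  qed
  also have "\<dots> = (\<integral>\<^sup>+x. indicator ?D x * ennreal s \<partial>?P ?B)"
    using \<open>s > 0\<close> by (subst nn_integral_cmult) auto
  also have "\<dots> = emeasure (?P ?B) ?D * ennreal s"
    by (subst nn_integral_multc) (auto simp: nn_integral_indicator)
  also have "emeasure (?P ?B) ?D = ennreal (unit_ball_vol (real (DIM('a) - 1)) * \<rho> ^ (DIM('a) - 1))"
    using emeasure_cball_aux[of ?B \<rho>] \<open>\<rho> > 0\<close> unfolding card by simp
  also have "\<dots> * ennreal s = ennreal (s * (unit_ball_vol (real (DIM('a) - 1)) * \<rho> ^ (DIM('a) - 1)))"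
    using assms by (subst ennreal_mult'[symmetric]) (auto simp: mult.commute)
  finally show ?thesis .
qed

lemma emeasure_cylinder:
  fixes i :: "'a::euclidean_space"
  assumes "i \<in> Basis" "\<rho> \<ge> 0" "s > 0" "DIM('a) \<ge> 2"
  shows "emeasure lborel (cylinder i s c \<rho>) =
    ennreal (s * (unit_ball_vol (real (DIM('a) - 1)) * \<rho> ^ (DIM('a) - 1)))"
proof (cases "\<rho> = 0")
  case False
  \<comment> \<open>Only the part of \<open>c\<close> orthogonal to \<open>i\<close> is translated
    away, which keeps the range of the coordinate along \<open>i\<close>.\<close>
  define d where "d = c - (c \<bullet> i) *\<^sub>R i"
  have di: "d \<bullet> i = 0" "\<And>b. b \<in> Basis - {i} \<Longrightarrow> d \<bullet> b = c \<bullet> b"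
    using assms(1) by (auto simp: d_def inner_diff_left inner_Basis)
  have "cylinder i s c \<rho> = {x. - d + x \<in> cylinder i s 0 \<rho>}"
    unfolding cylinder_def by (auto simp: di inner_diff_left inner_add_left)
  then show ?thesis
    using emeasure_lborel_translate[of "cylinder i s 0 \<rho>" "- d"] emeasure_cylinder_origin[of i \<rho> s] assms False
    by simp
next
  case True
  have "card (Basis - {i}) > 0" using assms by simp
  then have "Basis - {i} \<noteq> {}" by (metis card.empty less_irrefl)
  then obtain b where b: "b \<in> Basis - {i}" by blast
  \<comment> \<open>Radius 0 occurs for covering sets with at most one point. The cylinder is then a
    null set, and the formula also gives 0 because its exponent is positive.\<close>
  have "cylinder i s c \<rho> \<subseteq> {x. x \<bullet> b = c \<bullet> b}"
  proof
    fix x assume "x \<in> cylinder i s c \<rho>"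
    then have "(\<Sum>b\<in>Basis - {i}. ((x - c) \<bullet> b)\<^sup>2) \<le> 0" by (simp add: cylinder_def True)
    moreover have "((x - c) \<bullet> b)\<^sup>2 \<le> (\<Sum>b\<in>Basis - {i}. ((x - c) \<bullet> b)\<^sup>2)"
      using b by (intro member_le_sum) auto
    ultimately have "((x - c) \<bullet> b)\<^sup>2 \<le> 0" by linarith
    then show "x \<in> {x. x \<bullet> b = c \<bullet> b}" by (simp add: inner_diff_left)
  qed
  then have "negligible (cylinder i s c \<rho>)"
    using b by (intro negligible_subset[OF negligible_standard_hyperplane[of b "c \<bullet> b"]]) auto
  then have "cylinder i s c \<rho> \<in> null_sets lborel"
    by (auto simp: null_sets_completion_iff negligible_iff_null_sets)
  then have "emeasure lborel (cylinder i s c \<rho>) = 0" by (rule null_setsD1)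
  then show ?thesis using True assms(4) by (simp add: power_0_left)
qed

section \<open>Reduction modulo the lattice of the grid\<close>

definition grid_lattice :: "real \<Rightarrow> 'a::euclidean_space set" where
  "grid_lattice s = {v. \<forall>b\<in>Basis. (v \<bullet> b) / s \<in> \<int>}"

lemma countable_grid_lattice:
  assumes "s > 0"
  shows "countable (grid_lattice s :: 'a::euclidean_space set)"
proof -
  have "countable ((Basis :: 'a set) \<rightarrow>\<^sub>E (UNIV :: int set))"
    by (intro countable_PiE) auto
  moreover have "grid_lattice s \<subseteq> (\<lambda>k. \<Sum>b\<in>Basis. (s * of_int (k b)) *\<^sub>R b) ` ((Basis :: 'a set) \<rightarrow>\<^sub>E UNIV)"
  proof
    fix v :: 'a assume v: "v \<in> grid_lattice s"
    define k where "k = (\<lambda>b\<in>(Basis :: 'a set). \<lfloor>(v \<bullet> b) / s\<rfloor>)"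
    have "v = (\<Sum>b\<in>Basis. (v \<bullet> b) *\<^sub>R b)" by (simp add: euclidean_representation)
    also have "\<dots> = (\<Sum>b\<in>Basis. (s * of_int (k b)) *\<^sub>R b)"
    proof (intro sum.cong refl)
      fix b :: 'a assume b: "b \<in> Basis"
      then obtain z where z: "(v \<bullet> b) / s = of_int z"
        using v by (auto simp: grid_lattice_def elim!: Ints_cases)
      then have "v \<bullet> b = s * of_int z" using \<open>s > 0\<close> by (simp add: field_simps)
      then show "(v \<bullet> b) *\<^sub>R b = (s * of_int (k b)) *\<^sub>R b"
        using b z by (simp add: k_def)
    qed
    finally have "v = (\<Sum>b\<in>Basis. (s * of_int (k b)) *\<^sub>R b)" .
    then show "v \<in> (\<lambda>k. \<Sum>b\<in>Basis. (s * of_int (k b)) *\<^sub>R b) ` (Basis \<rightarrow>\<^sub>E UNIV)"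
      by (intro image_eqI[where x = k]) (auto simp: k_def)
  qed
  ultimately show ?thesis using countable_image countable_subset by blast
qed

lemma infinite_grid_lattice:
  assumes "s > 0"
  shows "infinite (grid_lattice s :: 'a::euclidean_space set)"
proof -
  obtain i :: 'a where i: "i \<in> Basis" using nonempty_Basis by blast
  have "inj (\<lambda>k::nat. (s * real k) *\<^sub>R i)"
    using i \<open>s > 0\<close> by (auto simp: inj_def nonzero_Basis)
  moreover have "range (\<lambda>k::nat. (s * real k) *\<^sub>R i) \<subseteq> grid_lattice s"
    using i \<open>s > 0\<close> by (auto simp: grid_lattice_def inner_Basis)
  ultimately show ?thesis using infinite_iff_countable_subset by blast
qed

lemma grid_lattice_translates_disjoint:
  fixes y :: "'a::euclidean_space"
  assumes "s > 0" "v \<in> grid_lattice s" "w \<in> grid_lattice s"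
    and "y - v \<in> box 0 (s *\<^sub>R One)" "y - w \<in> box 0 (s *\<^sub>R One)"
  shows "v = w"
proof (rule euclidean_eqI)
  fix b :: 'a assume b: "b \<in> Basis"
  have "0 < (y - v) \<bullet> b" "(y - v) \<bullet> b < s" "0 < (y - w) \<bullet> b" "(y - w) \<bullet> b < s"
    using assms(4,5) b by (auto simp: mem_box)
  then have "\<bar>v \<bullet> b - w \<bullet> b\<bar> < s"
    unfolding inner_diff_left by linarith
  then have "\<bar>(v \<bullet> b) / s - (w \<bullet> b) / s\<bar> < 1"
    using \<open>s > 0\<close> by (simp add: field_simps flip: diff_divide_distrib)
  moreover have "(v \<bullet> b) / s - (w \<bullet> b) / s \<in> \<int>"
    using assms(2,3) b by (auto simp: grid_lattice_def)
  ultimately have "(v \<bullet> b) / s - (w \<bullet> b) / s = 0"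
    using Ints_nonzero_abs_less1 by blast
  then show "v \<bullet> b = w \<bullet> b" using \<open>s > 0\<close> by simp
qed

text \<open>The image of \<open>Z\<close> in the torus of translations, read in the open period
  cube.\<close>

definition folded :: "real \<Rightarrow> 'a::euclidean_space set \<Rightarrow> 'a set" where
  "folded s Z = {t \<in> box 0 (s *\<^sub>R One). \<exists>v\<in>grid_lattice s. v + t \<in> Z}"

text \<open>Cut \<open>Z\<close> along the lattice translates of the open cube, which are disjoint,
  and move every piece back into the cube. Translation keeps the measure, and overlaps after moving
  can only lose some.\<close>

lemma folded_measure:
  fixes Z :: "'a::euclidean_space set"
  assumes "s > 0" and Z[measurable]: "Z \<in> sets borel"
  shows "folded s Z \<in> sets borel" "emeasure lborel (folded s Z) \<le> emeasure lborel Z"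
proof -
  obtain g where g: "bij_betw g (UNIV :: nat set) (grid_lattice s :: 'a set)"
    using bij_betw_from_nat_into[OF countable_grid_lattice infinite_grid_lattice] \<open>s > 0\<close> by blast
  define A where "A = (\<lambda>k. {y \<in> Z. y - g k \<in> box 0 (s *\<^sub>R One)})"
  have A [measurable]: "A k \<in> sets borel" for k
    unfolding A_def by measurable
  have "folded s Z = (\<Union>k. {t. g k + t \<in> A k})"
  proof -
    have "grid_lattice s = range g" using g by (simp add: bij_betw_def)
    then show ?thesis by (auto simp: folded_def A_def)
  qed
  moreover have m: "{t. g k + t \<in> A k} \<in> sets borel" for k
    by measurable
  ultimately show "folded s Z \<in> sets borel" by auto
  have "disjoint_family A"
  proof -
    have "g j = g k" if "y \<in> A j" "y \<in> A k" for y j k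
      using that g \<open>s > 0\<close> by (intro grid_lattice_translates_disjoint[of s _ _ y]) (auto simp: A_def bij_betw_def)
    then show ?thesis
      using g unfolding disjoint_family_on_def bij_betw_def inj_def by blast
  qed
  have "emeasure lborel (folded s Z) \<le> (\<Sum>k. emeasure lborel {t. g k + t \<in> A k})"
    unfolding \<open>folded s Z = (\<Union>k. {t. g k + t \<in> A k})\<close>
    using m by (intro emeasure_subadditive_countably) auto
  also have "\<dots> = (\<Sum>k. emeasure lborel (A k))"
    by (simp add: emeasure_lborel_translate)
  also have "\<dots> = emeasure lborel (\<Union>k. A k)"
    using \<open>disjoint_family A\<close> by (intro suminf_emeasure) auto
  also have "\<dots> \<le> emeasure lborel Z"
    by (intro emeasure_mono) (auto simp: A_def)
  finally show "emeasure lborel (folded s Z) \<le> emeasure lborel Z" .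
qed

text \<open>\<open>B i j\<close> contains the translations in the open cube for which a grid line
  parallel to \<open>i\<close> meets \<open>C j\<close>. Their total measure stays below that of the
  cube, so some translation is outside all of them.\<close>

lemma exists_grid_avoiding:
  fixes M :: "'a::euclidean_space set" and C :: "nat \<Rightarrow> 'a set"
  assumes D: "DIM('a) = n + 1" and "n \<ge> 1" "s > 0"
    and cover: "M \<subseteq> (\<Union>j. C j)" and bdd: "\<And>j. bounded (C j)"
    and small: "(\<Sum>j. ennreal (unit_ball_vol (real n) * (diameter (C j) / 2) ^ n)) < ennreal ((s / 2) ^ n / 3)"
  obtains t where "\<And>x i. x \<in> M \<Longrightarrow> i \<in> Basis \<Longrightarrow> \<exists>b\<in>Basis - {i}. ((x - t) \<bullet> b) / s \<notin> \<int>"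
proof -
  define S where "S = (\<Sum>j. ennreal (unit_ball_vol (real n) * (diameter (C j) / 2) ^ n))"
  define \<rho> where "\<rho> = (\<lambda>j. sqrt 3 / 2 * diameter (C j))"
  have d0: "diameter (C j) \<ge> 0" for j by (rule diameter_ge_0[OF bdd])
  have \<rho>0: "\<rho> j \<ge> 0" for j using d0 by (simp add: \<rho>_def)
  have "\<exists>c. C j \<subseteq> cball c (\<rho> j)" for j
    unfolding \<rho>_def using bdd by (intro bounded_subset_cball_diameter) (auto simp: compact_closure)
  then obtain c where c: "\<And>j. C j \<subseteq> cball (c j) (\<rho> j)" by metis
  define B where "B = (\<lambda>i j. folded s (cylinder i s (c j) (\<rho> j)))"
  have [measurable]: "B i j \<in> sets borel" for i j
    unfolding B_def using \<open>s > 0\<close> by (intro folded_measure) auto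
  have Bij: "emeasure lborel (B i j) \<le> ennreal (s * sqrt 3 ^ n) * ennreal (unit_ball_vol (real n) * (diameter (C j) / 2) ^ n)"
    if "i \<in> Basis" for i j
  proof -
    have "emeasure lborel (B i j) \<le> emeasure lborel (cylinder i s (c j) (\<rho> j))"
      unfolding B_def using \<open>s > 0\<close> by (intro folded_measure) auto
    also have "\<dots> = ennreal (s * (unit_ball_vol (real n) * \<rho> j ^ n))"
      using emeasure_cylinder[OF that \<rho>0 \<open>s > 0\<close>] D \<open>n \<ge> 1\<close> by simp
    also have "s * (unit_ball_vol (real n) * \<rho> j ^ n) =
        (s * sqrt 3 ^ n) * (unit_ball_vol (real n) * (diameter (C j) / 2) ^ n)"
      unfolding \<rho>_def by (simp add: power_mult_distrib power_divide)
    finally show ?thesis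
      using \<open>s > 0\<close> d0 by (simp add: ennreal_mult)
  qed
  have Bi: "emeasure lborel (\<Union>j. B i j) \<le> ennreal (s * sqrt 3 ^ n) * S" if "i \<in> Basis" for i
  proof -
    have "emeasure lborel (\<Union>j. B i j) \<le> (\<Sum>j. emeasure lborel (B i j))"
      by (intro emeasure_subadditive_countably) auto
    also have "\<dots> \<le> (\<Sum>j. ennreal (s * sqrt 3 ^ n) * ennreal (unit_ball_vol (real n) * (diameter (C j) / 2) ^ n))"
      using Bij[OF that] by (intro suminf_le) auto
    finally show ?thesis by (simp add: S_def ennreal_suminf_cmult)
  qed
  have "emeasure lborel (\<Union>i\<in>Basis. \<Union>j. B i j) \<le> (\<Sum>i\<in>Basis. emeasure lborel (\<Union>j. B i j))"
    by (intro emeasure_subadditive_finite) auto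
  also have "\<dots> \<le> (\<Sum>i\<in>(Basis :: 'a set). ennreal (s * sqrt 3 ^ n) * S)"
    using Bi by (rule sum_mono)
  also have "\<dots> = ennreal (real (n + 1)) * (ennreal (s * sqrt 3 ^ n) * S)"
    using D by (simp add: ennreal_of_nat_eq_real_of_nat)
  also have "\<dots> = ennreal (s * (real (n + 1) * sqrt 3 ^ n)) * S"
  proof -
    have "ennreal (s * (real (n + 1) * sqrt 3 ^ n)) = ennreal (real (n + 1)) * ennreal (s * sqrt 3 ^ n)"
      using \<open>s > 0\<close> by (subst ennreal_mult[symmetric]) (auto simp: algebra_simps)
    then show ?thesis by (simp only: mult.assoc)
  qed
  also have "\<dots> \<le> ennreal (s * (3 * 2 ^ n)) * S"
    using succ_mult_sqrt3_power_le[of n] \<open>s > 0\<close> by (intro mult_right_mono ennreal_leI mult_left_mono) auto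
  \<comment> \<open>The bound in \<open>small\<close> is chosen such that this product equals
    \<open>s ^ (n + 1)\<close>, the volume of a period cube.\<close>
  also have "\<dots> < ennreal (s * (3 * 2 ^ n)) * ennreal ((s / 2) ^ n / 3)"
    using small \<open>s > 0\<close> unfolding S_def[symmetric]
    by (intro ennreal_mult_strict_left_mono) auto
  also have "\<dots> = ennreal (s * (3 * 2 ^ n) * ((s / 2) ^ n / 3))"
    using \<open>s > 0\<close> by (subst ennreal_mult[symmetric]) auto
  also have "s * (3 * 2 ^ n) * ((s / 2) ^ n / 3) = s ^ (n + 1)"
    by (simp add: power_divide)
  also have "ennreal (s ^ (n + 1)) = emeasure lborel (box 0 (s *\<^sub>R One) :: 'a set)"
    using \<open>s > 0\<close> D by (subst emeasure_lborel_box) auto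
  finally have less: "emeasure lborel (\<Union>i\<in>Basis. \<Union>j. B i j) < emeasure lborel (box 0 (s *\<^sub>R One) :: 'a set)" .
  have "(\<Union>i\<in>Basis. \<Union>j. B i j) \<in> sets lborel"
    by (intro sets.finite_UN sets.countable_UN) auto
  then have "\<not> box 0 (s *\<^sub>R One) \<subseteq> (\<Union>i\<in>Basis. \<Union>j. B i j)"
    using less emeasure_mono[of "box 0 (s *\<^sub>R One)" "\<Union>i\<in>Basis. \<Union>j. B i j" lborel]
    by (meson not_le)
  then obtain t where t: "t \<in> box 0 (s *\<^sub>R One)" and nB: "\<And>i j. i \<in> Basis \<Longrightarrow> t \<notin> B i j" by blast
  show thesis
  proof (rule that, rule ccontr)
    fix x i assume x: "x \<in> M" and i: "i \<in> Basis"
      and "\<not> (\<exists>b\<in>Basis - {i}. ((x - t) \<bullet> b) / s \<notin> \<int>)"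
    then have int: "\<And>b. b \<in> Basis - {i} \<Longrightarrow> ((x - t) \<bullet> b) / s \<in> \<int>" by blast
    obtain j where j: "x \<in> C j" using cover x by blast
    \<comment> \<open>Removing the component along \<open>i\<close> leaves a lattice vector. Then
      \<open>v + t\<close> agrees with \<open>x\<close> in all other coordinates and with
      \<open>t\<close> along \<open>i\<close>, hence lies in the cylinder, which puts
      \<open>t\<close> into \<open>B i j\<close>.\<close>
    define v where "v = (x - t) - ((x - t) \<bullet> i) *\<^sub>R i"
    have vi: "v \<bullet> i = 0" and vb: "\<And>b. b \<in> Basis - {i} \<Longrightarrow> v \<bullet> b = (x - t) \<bullet> b"
      using i by (auto simp: v_def inner_diff_left inner_Basis)
    have "v \<in> grid_lattice s"
    proof -
      have "(v \<bullet> b) / s \<in> \<int>" if "b \<in> Basis" for b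
        using int[of b] vi vb[of b] that by (cases "b = i") auto
      then show ?thesis by (simp add: grid_lattice_def)
    qed
    moreover have "v + t \<in> cylinder i s (c j) (\<rho> j)"
    proof -
      have "(\<Sum>b\<in>Basis - {i}. ((v + t - c j) \<bullet> b)\<^sup>2) = (\<Sum>b\<in>Basis - {i}. ((x - c j) \<bullet> b)\<^sup>2)"
        using vb by (intro sum.cong) (auto simp: inner_diff_left inner_add_left)
      also have "\<dots> \<le> (\<Sum>b\<in>Basis. ((x - c j) \<bullet> b)\<^sup>2)"
        by (intro sum_mono2) auto
      also have "\<dots> = (norm (x - c j))\<^sup>2"
        by (simp add: norm_eq_sqrt_inner euclidean_inner[of "x - c j" "x - c j"] power2_eq_square sum_nonneg)
      also have "\<dots> \<le> (\<rho> j)\<^sup>2"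
        using c[of j] j by (intro power_mono) (auto simp: dist_norm norm_minus_commute)
      finally show ?thesis
        using t i by (auto simp: cylinder_def inner_add_left vi mem_box)
    qed
    ultimately have "t \<in> B i j" using t by (auto simp: B_def folded_def)
    then show False using nB[OF i] by blast
  qed
qed

section \<open>The width estimate\<close>

lemma linf_width_le:
  fixes M :: "'a::euclidean_space set"
  assumes "compact M" "M \<noteq> {}" "polyhedron_dim_le k K" "continuous_on M \<phi>" "\<phi> ` M \<subseteq> K"
    and close: "\<And>x. x \<in> M \<Longrightarrow> infnorm (x - \<phi> x) \<le> r"
  shows "linf_width k M \<le> r"
proof -
  let ?W = "{r. \<exists>K \<phi>. polyhedron_dim_le k K \<and> continuous_on M \<phi> \<and> \<phi> ` M \<subseteq> K \<and>
                       r = (SUP x\<in>M. infnorm (x - \<phi> x))}"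
  \<comment> \<open>An infimum of reals is a lower bound only for a set bounded below. Compactness
    of \<open>M\<close> makes each supremum one of a bounded family of nonnegative numbers.\<close>
  have "0 \<le> w" if w: "w \<in> ?W" for w
  proof -
    obtain \<psi> where \<psi>: "continuous_on M \<psi>" "w = (SUP x\<in>M. infnorm (x - \<psi> x))"
      using w by blast
    obtain x where "x \<in> M" using \<open>M \<noteq> {}\<close> by blast
    have "continuous_on M (\<lambda>x. infnorm (x - \<psi> x))"
      using \<psi>(1) by (intro continuous_intros)
    then have "bdd_above ((\<lambda>x. infnorm (x - \<psi> x)) ` M)"
      using compact_continuous_image[OF _ \<open>compact M\<close>]
      by (intro bounded_imp_bdd_above compact_imp_bounded)
    then have "infnorm (x - \<psi> x) \<le> w"
      unfolding \<psi>(2) using \<open>x \<in> M\<close> by (rule cSUP_upper[rotated])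
    then show ?thesis using infnorm_pos_le[of "x - \<psi> x"] by linarith
  qed
  then have "bdd_below ?W" by (rule bdd_belowI)
  moreover have "(SUP x\<in>M. infnorm (x - \<phi> x)) \<in> ?W" using assms by blast
  ultimately have "linf_width k M \<le> (SUP x\<in>M. infnorm (x - \<phi> x))"
    unfolding linf_width_def by (intro cInf_lower)
  also have "\<dots> \<le> r" using \<open>M \<noteq> {}\<close> close by (rule cSUP_least)
  finally show ?thesis .
qed

lemma linf_width_le_of_hausdorff_measure_less:
  fixes M :: "'a::euclidean_space set"
  assumes "n \<ge> 1" "DIM('a) = n + 1" "compact M" "M \<noteq> {}" "r > 0"
    and less: "hausdorff_measure n M < ennreal (r ^ n / 3)"
  shows "linf_width (n - 1) M \<le> r"
proof -
  \<comment> \<open>The scale 1 is arbitrary: the cover enters only through its sum of powers of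
    diameters.\<close>
  have "hausdorff_pre n 1 M \<le> hausdorff_measure n M"
    unfolding hausdorff_measure_def by (rule SUP_upper) simp
  then have "hausdorff_pre n 1 M < ennreal (r ^ n / 3)" using less by (rule order_le_less_trans)
  then obtain C :: "nat \<Rightarrow> 'a set" where C: "M \<subseteq> (\<Union>i. C i)" "\<And>i. bounded (C i)"
    "(\<Sum>i. ennreal (unit_ball_vol (real n) * (diameter (C i) / 2) ^ n)) < ennreal (r ^ n / 3)"
    unfolding hausdorff_pre_def INF_less_iff by blast
  \<comment> \<open>With the mesh \<open>2 * r\<close> the displacement is at most \<open>r\<close>,
    and \<open>(s / 2) ^ n / 3\<close> becomes \<open>r ^ n / 3\<close>.\<close>
  obtain t where t: "\<And>x i. x \<in> M \<Longrightarrow> i \<in> Basis \<Longrightarrow> \<exists>b\<in>Basis - {i}. ((x - t) \<bullet> b) / (2 * r) \<notin> \<int>"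
    by (rule exists_grid_avoiding[OF assms(2,1), of "2 * r" M C]) (use C \<open>r > 0\<close> in auto)
  obtain K \<phi> where K: "polyhedron_dim_le (DIM('a) - 2) K" "continuous_on M \<phi>" "\<phi> ` M \<subseteq> K"
    "\<And>x. x \<in> M \<Longrightarrow> infnorm (x - \<phi> x) \<le> (2 * r) / 2"
    by (rule linf_approximation_avoiding_grid_lines[OF assms(3,4), of "2 * r" t])
       (use t \<open>r > 0\<close> in auto)
  have "DIM('a) - 2 = n - 1" using assms(2) by simp
  then show ?thesis using K assms(3,4) by (intro linf_width_le[of M "n - 1" K \<phi>]) auto
qed

theorem theorem1p2:
  fixes M :: "'a::euclidean_space set" and n :: nat
  assumes "n \<ge> 1" and "DIM('a) = n + 1"
    and "closed_hypersurface M"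
  shows "hausdorff_measure n M < \<infinity> \<and>
         linf_width (n - 1) M
           \<le> 3 powr (1 / real n) * enn2real (hausdorff_measure n M) powr (1 / real n) \<and>
         3 powr (1 / real n) * enn2real (hausdorff_measure n M) powr (1 / real n)
           \<le> 3 * enn2real (hausdorff_measure n M) powr (1 / real n)"
proof (intro conjI)
  show fin: "hausdorff_measure n M < \<infinity>"
    using closed_hypersurface_hausdorff_finite[of M] assms by simp
  define h where "h = enn2real (hausdorff_measure n M)"
  have "h \<ge> 0" by (simp add: h_def)
  have H: "hausdorff_measure n M = ennreal h"
    using fin by (simp add: h_def)
  have M: "compact M" "M \<noteq> {}" using assms(3) by (auto simp: closed_hypersurface_def)
  have "linf_width (n - 1) M \<le> 3 powr (1 / real n) * h powr (1 / real n)"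
  \<comment> \<open>The covering argument needs a strict inequality between the measure and
    \<open>r ^ n / 3\<close>, so the bound is shown for every larger \<open>r\<close>; such an
    \<open>r\<close> is positive even if \<open>h = 0\<close>.\<close>
  proof (rule dense_ge)
    fix r assume r: "3 powr (1 / real n) * h powr (1 / real n) < r"
    have "0 \<le> 3 powr (1 / real n) * h powr (1 / real n)" by simp
    then have "r > 0" using r by linarith
    have "((3 * h) powr (1 / real n)) ^ n = ((3 * h) powr (1 / real n)) powr real n"
      using \<open>n \<ge> 1\<close> by (intro powr_realpow'[symmetric]) auto
    also have "\<dots> = (3 * h) powr (1 / real n * real n)" by (rule powr_powr)
    also have "\<dots> = 3 * h" using \<open>n \<ge> 1\<close> \<open>h \<ge> 0\<close> by simp
    finally have "3 * h = ((3 * h) powr (1 / real n)) ^ n" ..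
    also have "\<dots> < r ^ n"
      using r \<open>n \<ge> 1\<close> \<open>h \<ge> 0\<close> by (intro power_strict_mono) (auto simp: powr_mult)
    finally have "hausdorff_measure n M < ennreal (r ^ n / 3)"
      unfolding H using \<open>h \<ge> 0\<close> by (intro ennreal_lessI) auto
    then show "linf_width (n - 1) M \<le> r"
      using linf_width_le_of_hausdorff_measure_less assms(1,2) M \<open>r > 0\<close> by blast
  qed
  then show "linf_width (n - 1) M
      \<le> 3 powr (1 / real n) * enn2real (hausdorff_measure n M) powr (1 / real n)"
    by (simp add: h_def)
  have "(3::real) powr (1 / real n) \<le> 3 powr 1"
    using assms(1) by (intro powr_mono) auto
  then show "3 powr (1 / real n) * enn2real (hausdorff_measure n M) powr (1 / real n)
      \<le> 3 * enn2real (hausdorff_measure n M) powr (1 / real n)"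
    by (intro mult_right_mono) auto
qed

end
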